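(* There is no quasi-isometric embedding $\mathrm{H}^2\to T\times\mathbb{R}^m$ for any metric tree $T$ and any integer $m\ge 0$.
   Context: $\mathrm{H}^2$ is the real hyperbolic plane of curvature $-1$. A metric tree is a connected graph without circuits, with its edges identified with compact intervals, equipped with the induced path metric; no local finiteness is assumed. $T\times\mathbb{R}^m$ carries the Euclidean ($\ell^2$) product metric. A (not necessarily continuous) map $f:X\to Y$ between metric spaces is quasi-isometric (a quasi-isometric embedding) if there are constants $\ell\ge 1$, $\mu\ge 0$ such that $\frac1\ell|x-x'|-\mu\le|f(x)-f(x')|\le \ell|x-x'|+\mu$ for all $x,x'\in X$. *)

theory Defs
  imports "HOL-Analysis.Analysis"
begin

section \<open>The hyperbolic plane\<close>

text \<open>Upper half-plane model, with the distance function of the Riemannian metric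
  of constant curvature \<open>-1\<close>.\<close>

definition hyp_plane :: "complex set" where
  "hyp_plane = {z. Im z > 0}"

definition hyp_dist :: "complex \<Rightarrow> complex \<Rightarrow> real" where
  "hyp_dist z w = arcosh (1 + (cmod (z - w))\<^sup>2 / (2 * Im z * Im w))"


section \<open>Metric trees\<close>

text \<open>
  A metric graph is presented by its geometric realization: the vertices are points of the
  realization, and each edge \<open>e\<close> is identified with the compact interval
  \<open>{0..len G e}\<close> by the map \<open>chart G e\<close>, whose values at the two ends of the interval are
  the endpoints of \<open>e\<close>. Loops, multiple edges, vertices of infinite degree and arbitrarily
  short edges are all allowed here.
\<close>

record ('p, 'e) metric_graph =
  verts :: "'p set"
  edges :: "'e set"
  len :: "'e \<Rightarrow> real"
  chart :: "'e \<Rightarrow> real \<Rightarrow> 'p"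

definition points :: "('p, 'e) metric_graph \<Rightarrow> 'p set" where
  "points G = verts G \<union> (\<Union>e\<in>edges G. chart G e ` {0..len G e})"

definition wf_metric_graph :: "('p, 'e) metric_graph \<Rightarrow> bool" where
  "wf_metric_graph G \<longleftrightarrow>
     (\<forall>e\<in>edges G. 0 < len G e
        \<and> chart G e 0 \<in> verts G \<and> chart G e (len G e) \<in> verts G
        \<and> inj_on (chart G e) {0<..<len G e}
        \<and> chart G e ` {0<..<len G e} \<inter> verts G = {})
   \<and> (\<forall>e\<in>edges G. \<forall>e'\<in>edges G. e \<noteq> e' \<longrightarrow>
        chart G e ` {0<..<len G e} \<inter> chart G e' ` {0<..<len G e'} = {})"

definition joins :: "('p, 'e) metric_graph \<Rightarrow> 'p \<Rightarrow> 'e \<Rightarrow> 'p \<Rightarrow> bool" where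
  "joins G u e v \<longleftrightarrow> e \<in> edges G \<and>
     (chart G e 0 = u \<and> chart G e (len G e) = v \<or> chart G e 0 = v \<and> chart G e (len G e) = u)"

definition connected_graph :: "('p, 'e) metric_graph \<Rightarrow> bool" where
  "connected_graph G \<longleftrightarrow> verts G \<noteq> {} \<and>
     (\<forall>u\<in>verts G. \<forall>v\<in>verts G. (\<lambda>x y. \<exists>e. joins G x e y)\<^sup>*\<^sup>* u v)"

text \<open>The edge \<open>es ! i\<close> joins the vertex \<open>vs ! i\<close> to its cyclic successor. A loop is a
  circuit of length \<open>1\<close>, and a pair of parallel edges is one of length \<open>2\<close>.\<close>

definition circuit :: "('p, 'e) metric_graph \<Rightarrow> 'p list \<Rightarrow> 'e list \<Rightarrow> bool" where
  "circuit G vs es \<longleftrightarrow> es \<noteq> [] \<and> length vs = length es \<and> distinct vs \<and> distinct es \<and>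
     (\<forall>i<length es. joins G (vs ! i) (es ! i) (vs ! (Suc i mod length es)))"

definition metric_tree :: "('p, 'e) metric_graph \<Rightarrow> bool" where
  "metric_tree G \<longleftrightarrow> wf_metric_graph G \<and> connected_graph G \<and> (\<nexists>vs es. circuit G vs es)"

text \<open>\<open>path_of_length G x y r\<close>: the points \<open>x\<close> and \<open>y\<close> are joined by a path of length \<open>r\<close> that
  is a finite concatenation of segments, each contained in a single edge.\<close>

inductive path_of_length :: "('p, 'e) metric_graph \<Rightarrow> 'p \<Rightarrow> 'p \<Rightarrow> real \<Rightarrow> bool"
  for G :: "('p, 'e) metric_graph" where
  refl: "x \<in> points G \<Longrightarrow> path_of_length G x x 0"
| step: "path_of_length G x (chart G e s) r \<Longrightarrow> e \<in> edges G \<Longrightarrow>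
         s \<in> {0..len G e} \<Longrightarrow> t \<in> {0..len G e} \<Longrightarrow>
         path_of_length G x (chart G e t) (r + \<bar>s - t\<bar>)"

definition path_dist :: "('p, 'e) metric_graph \<Rightarrow> 'p \<Rightarrow> 'p \<Rightarrow> real" where
  "path_dist G x y = Inf {r. path_of_length G x y r}"


section \<open>Euclidean distance and quasi-isometric embeddings\<close>

text \<open>The underlying set of \<open>\<real>\<^sup>m\<close> is \<^term>\<open>topspace (Euclidean_space m)\<close>, the set of real
  sequences that vanish from index \<open>m\<close> on; for \<open>m = 0\<close> it is a single point.\<close>

definition euclid_dist :: "nat \<Rightarrow> (nat \<Rightarrow> real) \<Rightarrow> (nat \<Rightarrow> real) \<Rightarrow> real" where
  "euclid_dist m x y = L2_set (\<lambda>i. x i - y i) {..<m}"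

definition quasi_isometric_embedding ::
  "'a set \<Rightarrow> ('a \<Rightarrow> 'a \<Rightarrow> real) \<Rightarrow> 'b set \<Rightarrow> ('b \<Rightarrow> 'b \<Rightarrow> real) \<Rightarrow> ('a \<Rightarrow> 'b) \<Rightarrow> bool" where
  "quasi_isometric_embedding X dX Y dY f \<longleftrightarrow> f \<in> X \<rightarrow> Y \<and>
     (\<exists>l \<mu>. l \<ge> 1 \<and> \<mu> \<ge> 0 \<and>
       (\<forall>x\<in>X. \<forall>x'\<in>X. 1 / l * dX x x' - \<mu> \<le> dY (f x) (f x')
                     \<and> dY (f x) (f x') \<le> l * dX x x' + \<mu>))"

end

theory Submission
  imports Defs "HOL-Library.Sublist"
begin

text \<open>
  A horocycle already cannot be mapped to \<open>T \<times> \<real>\<^sup>m\<close> in the required way. In the upper half-plane,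
  the points \<open>t + \<i>\<close> with \<open>t\<close> a natural number lie on a horocycle, and the distance of two of them
  is \<open>2 ln \<bar>s - t\<bar>\<close> up to an additive error (\<open>horocycle_dist_bounds\<close>). A quasi-isometric embedding
  therefore produces sequences \<open>g\<close> in \<open>T\<close> and \<open>h\<close> in \<open>\<real>\<^sup>m\<close> with these properties: both move by a
  bounded amount in one step, both stay in a region of diameter \<open>O(ln N)\<close> during the first \<open>N\<close>
  steps, and if \<open>\<bar>s - t\<bar>\<close> is at least a fixed fraction of \<open>N\<close> then \<open>g\<close> and \<open>h\<close> cannot both move by
  much less than \<open>ln N\<close> between the times \<open>s\<close> and \<open>t\<close>.

  These properties are contradictory (\<open>no_log_embedding\<close>), because of two facts.

  \<^item> \<^emph>\<open>Euclidean space is doubling.\<close> At times when \<open>g\<close> is within a small multiple \<open>r\<close> of \<open>ln N\<close>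
    from a given point of the tree, \<open>h\<close> has to separate: such times that are a fixed fraction of \<open>N\<close>
    apart yield points of \<open>\<real>\<^sup>m\<close> whose mutual distances are all comparable with \<open>ln N\<close>. There are
    fewer than \<open>K\<close> of them, with \<open>K\<close> independent of \<open>N\<close> (\<open>euclid_packing_bound\<close>). So every time
    interval whose length is a fixed fraction of \<open>N\<close> contains a subinterval of \<open>1/(2K)\<close> of that
    length during which \<open>g\<close> avoids the given ball of radius \<open>r\<close>.

  \<^item> \<^emph>\<open>Paths in trees have cut points.\<close> Let \<open>q\<close> be the lowest point, with respect to a root, that
    \<open>g\<close> visits during a time interval. As \<open>g\<close> makes small steps, everything it visits in this interval
    lies above \<open>q\<close>, up to a bounded error (\<open>coarse_path_lowest_point\<close>). While it is away from
    the ball of radius \<open>r\<close> about \<open>q\<close>, it is thus higher than \<open>q\<close> by at least \<open>r\<close>, up to that error.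

  Alternating the two, \<open>g\<close> climbs by a fixed multiple of \<open>ln N\<close> each time that the interval shrinks
  by the factor \<open>2K\<close>. After a number \<open>J\<close> of rounds that is also independent of \<open>N\<close>, it has climbed
  more than the diameter \<open>O(ln N)\<close> permits, while the interval, of length \<open>N/(2K)\<^sup>J\<close>, is still
  nonempty for large \<open>N\<close>.

  Of the tree, the argument uses only that its path metric is \<open>0\<close>-hyperbolic, in the form of the
  ultrametric inequality for the Gromov products with respect to a root. To see this
  (\<open>zero_hyperbolic_path_dist\<close>), every point is described by its height over the root and by the
  list of edges that lead to it. The absence of circuits makes this list unique, and
  the Gromov product of two points is the length of the common part of the two routes
  from the root.
\<close>

section \<open>Packing in Euclidean space\<close>

text \<open>This is the doubling property of \<open>\<real>\<^sup>m\<close>, in scale-invariant form: the bound \<open>K\<close> depends only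
  on \<open>m\<close> and on the ratio \<open>C\<close> of the largest to the smallest distance. Points in the same cell of a
  cubical grid of mesh \<open>\<rho>/(m + 1)\<close> are closer than \<open>\<rho>\<close>, and only boundedly many cells lie
  within \<open>C \<rho>\<close> of the first point.\<close>

lemma euclid_packing_bound:
  fixes C :: real
  shows "\<exists>K::nat. K > 0 \<and> (\<forall>\<rho>>0. \<forall>y. \<not> (\<forall>i<K. \<forall>j<K. i \<noteq> j \<longrightarrow>
           \<rho> \<le> euclid_dist m (y i) (y j) \<and> euclid_dist m (y i) (y j) \<le> C * \<rho>))"
proof -
  define B :: int where "B = \<lceil>\<bar>C\<bar> * (real m + 1)\<rceil> + 1"
  define F :: "(nat \<Rightarrow> int) set" where "F = {..<m} \<rightarrow>\<^sub>E {-B..B}"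
  have finF: "finite F" by (simp add: F_def finite_PiE)
  have "\<not> (\<forall>i<Suc (card F). \<forall>j<Suc (card F). i \<noteq> j \<longrightarrow>
           \<rho> \<le> euclid_dist m (y i) (y j) \<and> euclid_dist m (y i) (y j) \<le> C * \<rho>)"
    if \<rho>: "\<rho> > 0" for \<rho> and y :: "nat \<Rightarrow> nat \<Rightarrow> real"
  proof
    assume sep: "\<forall>i<Suc (card F). \<forall>j<Suc (card F). i \<noteq> j \<longrightarrow>
           \<rho> \<le> euclid_dist m (y i) (y j) \<and> euclid_dist m (y i) (y j) \<le> C * \<rho>"
    \<comment> \<open>The summand 1 makes the diameter \<open>m \<delta>\<close> of a cell strictly smaller than \<open>\<rho>\<close>, also for \<open>m = 0\<close>.\<close>
    define \<delta> where "\<delta> = \<rho> / (real m + 1)"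
    have \<delta>: "\<delta> > 0" using \<rho> by (simp add: \<delta>_def)
    define cell where "cell = (\<lambda>i. \<lambda>k\<in>{..<m}. \<lfloor>(y i k - y 0 k) / \<delta>\<rfloor>)"
    have "cell i \<in> F" if i: "i < Suc (card F)" for i
    proof -
      have "\<lfloor>(y i k - y 0 k) / \<delta>\<rfloor> \<in> {-B..B}" if k: "k < m" for k
      proof -
        have "\<bar>y i k - y 0 k\<bar> \<le> \<bar>C\<bar> * \<rho>"
        proof (cases "i = 0")
          case False
          have "\<bar>y i k - y 0 k\<bar> \<le> euclid_dist m (y i) (y 0)"
            using member_le_L2_set[of "{..<m}" k "\<lambda>k. \<bar>y i k - y 0 k\<bar>"] k
            by (simp add: euclid_dist_def L2_set_def)
          also have "\<dots> \<le> C * \<rho>" using sep i False by blast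
          also have "\<dots> \<le> \<bar>C\<bar> * \<rho>" using \<rho> by (simp add: mult_right_mono)
          finally show ?thesis .
        qed (use \<rho> in simp)
        hence "\<bar>y i k - y 0 k\<bar> / \<delta> \<le> (\<bar>C\<bar> * \<rho>) / \<delta>"
          using \<delta> by (simp add: divide_right_mono)
        also have "(\<bar>C\<bar> * \<rho>) / \<delta> = \<bar>C\<bar> * (real m + 1)"
          using \<rho> by (simp add: \<delta>_def)
        finally have "\<bar>(y i k - y 0 k) / \<delta>\<bar> \<le> \<bar>C\<bar> * (real m + 1)"
          using \<delta> by (simp add: abs_divide)
        hence "(y i k - y 0 k) / \<delta> \<le> \<bar>C\<bar> * (real m + 1)"
          "- (\<bar>C\<bar> * (real m + 1)) \<le> (y i k - y 0 k) / \<delta>"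
          by (simp_all only: abs_le_iff) linarith
        thus ?thesis unfolding B_def atLeastAtMost_iff by linarith
      qed
      thus ?thesis by (auto simp: F_def cell_def)
    qed
    hence "\<not> inj_on cell {..<Suc (card F)}"
      using card_inj_on_le[of cell "{..<Suc (card F)}" F] finF by auto
    then obtain i j where ij: "i < Suc (card F)" "j < Suc (card F)" "i \<noteq> j" "cell i = cell j"
      by (auto simp: inj_on_def)
    have small: "\<bar>y i k - y j k\<bar> \<le> \<delta>" if k: "k < m" for k
    proof -
      have "\<lfloor>(y i k - y 0 k) / \<delta>\<rfloor> = \<lfloor>(y j k - y 0 k) / \<delta>\<rfloor>"
        using fun_cong[OF ij(4), of k] k by (simp add: cell_def)
      hence "\<bar>(y i k - y 0 k) / \<delta> - (y j k - y 0 k) / \<delta>\<bar> \<le> 1" by linarith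
      moreover have "(y i k - y 0 k) / \<delta> - (y j k - y 0 k) / \<delta> = (y i k - y j k) / \<delta>"
        by (simp add: diff_divide_distrib)
      ultimately show ?thesis using \<delta> by (simp add: abs_divide)
    qed
    have "euclid_dist m (y i) (y j) \<le> (\<Sum>k<m. \<bar>y i k - y j k\<bar>)"
      unfolding euclid_dist_def by (rule L2_set_le_sum_abs)
    also have "\<dots> \<le> real m * \<delta>"
      using sum_bounded_above[of "{..<m}" "\<lambda>k. \<bar>y i k - y j k\<bar>" \<delta>] small by simp
    also have "\<dots> < (real m + 1) * \<delta>" using \<delta> by (simp add: algebra_simps)
    also have "\<dots> = \<rho>" by (simp add: \<delta>_def)
    finally show False using sep ij by fastforce
  qed
  thus ?thesis by blast
qed


section \<open>Distances along a horocycle\<close>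

text \<open>For \<open>k = t - s\<close> the distance is \<open>arcosh (1 + k\<^sup>2/2)\<close>, and \<open>arcosh y\<close> lies between
  \<open>ln y\<close> and \<open>ln (2 y)\<close>.\<close>

lemma horocycle_dist_bounds:
  assumes "s < t"
  shows "2 * ln (real t - real s) - 1 \<le> hyp_dist (Complex (real s) 1) (Complex (real t) 1)"
    and "hyp_dist (Complex (real s) 1) (Complex (real t) 1) \<le> 2 * ln (real t - real s) + 2"
proof -
  define k where "k = real t - real s"
  have k: "k \<ge> 1" using assms by (simp add: k_def)
  define y where "y = 1 + k\<^sup>2 / 2"
  have "(cmod (Complex (real s) 1 - Complex (real t) 1))\<^sup>2 = k\<^sup>2"
    by (simp add: cmod_def k_def power2_commute)
  hence d: "hyp_dist (Complex (real s) 1) (Complex (real t) 1) = ln (y + sqrt (y\<^sup>2 - 1))"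
    using k by (simp add: hyp_dist_def y_def arcosh_real_def)
  have y1: "y \<ge> 1" by (simp add: y_def)
  have e2: "exp (1::real) \<ge> 2" using exp_ge_add_one_self[of 1] by simp
  have lnk2: "ln (k\<^sup>2) = 2 * ln k" using k by (simp add: ln_realpow)
  have "2 * ln k - 1 \<le> ln (k\<^sup>2) - ln 2"
    using e2 lnk2 by (metis diff_left_mono exp_gt_zero exp_le_cancel_iff exp_ln zero_less_numeral)
  also have "\<dots> = ln (k\<^sup>2 / 2)" using k by (simp add: ln_div)
  also have "\<dots> \<le> ln (y + sqrt (y\<^sup>2 - 1))"
  proof -
    have "k\<^sup>2 / 2 \<le> y + sqrt (y\<^sup>2 - 1)" using y1 by (simp add: y_def add_nonneg_nonneg)
    moreover have "0 < k\<^sup>2 / 2" using k by simp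
    ultimately show ?thesis by (simp add: ln_mono)
  qed
  finally show "2 * ln (real t - real s) - 1 \<le> hyp_dist (Complex (real s) 1) (Complex (real t) 1)"
    unfolding d k_def .
  have "sqrt (y\<^sup>2 - 1) \<le> y" using y1 by (intro real_le_lsqrt) auto
  hence "y + sqrt (y\<^sup>2 - 1) \<le> 2 + k\<^sup>2" by (simp add: y_def)
  also have "\<dots> \<le> 4 * k\<^sup>2" using one_le_power[OF k, of 2] by simp
  also have "\<dots> \<le> (exp 1)\<^sup>2 * k\<^sup>2"
    using power_mono[OF e2, of 2] by (intro mult_right_mono) auto
  also have "(exp 1)\<^sup>2 = exp (2::real)" using exp_double[of "1::real"] by simp
  finally have "y + sqrt (y\<^sup>2 - 1) \<le> exp 2 * k\<^sup>2" .
  moreover have "0 < y + sqrt (y\<^sup>2 - 1)" using y1 by (simp add: add_pos_nonneg)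
  ultimately have "ln (y + sqrt (y\<^sup>2 - 1)) \<le> ln (exp 2 * k\<^sup>2)" by (simp add: ln_mono)
  also have "\<dots> = 2 * ln k + 2" using k lnk2 by (simp add: ln_mult)
  finally show "hyp_dist (Complex (real s) 1) (Complex (real t) 1) \<le> 2 * ln (real t - real s) + 2"
    unfolding d k_def .
qed

section \<open>Coarse paths in 0-hyperbolic spaces\<close>

definition gromov_product :: "('a \<Rightarrow> 'a \<Rightarrow> real) \<Rightarrow> 'a \<Rightarrow> 'a \<Rightarrow> 'a \<Rightarrow> real" where
  "gromov_product d p x y = (d p x + d p y - d x y) / 2"

text \<open>Distinct points may have distance \<open>0\<close>, so \<open>d\<close> is only a pseudometric. The last condition is the
  four-point condition for quadruples that contain the base point \<open>p\<close>.\<close>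

locale zero_hyperbolic =
  fixes X :: "'a set" and d :: "'a \<Rightarrow> 'a \<Rightarrow> real" and p :: 'a
  assumes base: "p \<in> X"
    and dist_refl: "x \<in> X \<Longrightarrow> d x x = 0"
    and commute: "x \<in> X \<Longrightarrow> y \<in> X \<Longrightarrow> d x y = d y x"
    and triangle: "x \<in> X \<Longrightarrow> y \<in> X \<Longrightarrow> z \<in> X \<Longrightarrow> d x z \<le> d x y + d y z"
    and ultrametric: "x \<in> X \<Longrightarrow> y \<in> X \<Longrightarrow> z \<in> X \<Longrightarrow>
      min (gromov_product d p x y) (gromov_product d p y z) \<le> gromov_product d p x z"
begin

lemma nonneg: "x \<in> X \<Longrightarrow> y \<in> X \<Longrightarrow> 0 \<le> d x y"
  using triangle[of x y x] commute[of x y] dist_refl[of x] by simp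

text \<open>Consecutive points of a coarse path that stays outside the ball of radius \<open>D\<close> about the base
  point have Gromov product at least \<open>D - \<sigma>/2\<close>. The ultrametric inequality passes this on to the
  two ends without any loss, however long the path is. This is where it matters that the space is
  \<open>0\<close>-hyperbolic and not merely \<open>\<delta>\<close>-hyperbolic.\<close>

lemma coarse_path_chain:
  assumes X: "\<And>t. g t \<in> X"
    and step: "\<And>t. a \<le> t \<Longrightarrow> t < b \<Longrightarrow> d (g t) (g (Suc t)) \<le> \<sigma>"
    and above: "\<And>t. a \<le> t \<Longrightarrow> t \<le> b \<Longrightarrow> D \<le> d p (g t)"
    and ab: "a \<le> b" and \<sigma>: "\<sigma> \<ge> 0"
  shows "D - \<sigma> / 2 \<le> gromov_product d p (g a) (g b)"
  using ab step above
proof (induction b rule: dec_induct)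
  case base
  thus ?case using X dist_refl \<sigma> by (simp add: gromov_product_def)
next
  case (step n)
  have "D - \<sigma> / 2 \<le> gromov_product d p (g a) (g n)" using step by simp
  moreover have "D - \<sigma> / 2 \<le> gromov_product d p (g n) (g (Suc n))"
    using step.prems(1)[of n] step.prems(2)[of n] step.prems(2)[of "Suc n"] step.hyps
    by (simp add: gromov_product_def)
  ultimately show ?case using ultrametric[OF X X X, of a n "Suc n"] by linarith
qed

text \<open>In a tree, a path that never goes below its point \<open>q\<close> closest to the root stays above \<open>q\<close>:
  the segment from the root to any of its points runs through \<open>q\<close>. The error \<open>\<sigma>\<close> accounts for the
  jumps of a coarse path.\<close>

lemma coarse_path_lowest_point:
  assumes X: "\<And>t. g t \<in> X"
    and step: "\<And>t. d (g t) (g (Suc t)) \<le> \<sigma>"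
    and above: "\<And>t. t \<in> {a..<b} \<Longrightarrow> d p (g t0) \<le> d p (g t)"
    and t0: "t0 \<in> {a..<b}" and t: "t \<in> {a..<b}"
  shows "d p (g t0) + d (g t) (g t0) - \<sigma> \<le> d p (g t)"
proof -
  have \<sigma>: "\<sigma> \<ge> 0" using nonneg[OF X X, of 0 "Suc 0"] step[of 0] by simp
  have "d p (g t0) - \<sigma> / 2 \<le> gromov_product d p (g t) (g t0)"
  proof (cases "t \<le> t0")
    case True
    show ?thesis
      by (rule coarse_path_chain) (use X step above t0 t True \<sigma> in auto)
  next
    case False
    have "d p (g t0) - \<sigma> / 2 \<le> gromov_product d p (g t0) (g t)"
      by (rule coarse_path_chain) (use X step above t0 t False \<sigma> in auto)
    thus ?thesis using commute[OF X X, of t t0] by (simp add: gromov_product_def)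
  qed
  thus ?thesis by (simp add: gromov_product_def field_simps)
qed

text \<open>The hypotheses say that \<open>t \<mapsto> (g t, h t)\<close> is a quasi-isometric embedding for the distance
  \<open>ln \<bar>s - t\<bar>\<close> on the natural numbers. The order of choices is essential. The number \<open>K\<close> comes from the packing bound for the
  ratio \<open>(2 A \<Lambda>) / (\<Lambda> / (2 A))\<close> of the extreme distances at scale \<open>\<Lambda>\<close>. The number \<open>J\<close> of rounds is
  such that \<open>J\<close> climbs of at least \<open>\<Lambda> / (16 A)\<close> exceed the diameter \<open>2 A \<Lambda>\<close>. Only then \<open>M\<close>, the
  length of the last time interval, is taken so large that \<open>\<Lambda> = ln M\<close> dominates all additive
  constants, among them the difference \<open>J ln (2 K)\<close> between \<open>ln N\<close> and \<open>ln M\<close>.\<close>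

lemma no_log_embedding:
  fixes g :: "nat \<Rightarrow> 'a" and h :: "nat \<Rightarrow> nat \<Rightarrow> real" and A B :: real
  assumes X: "\<And>t. g t \<in> X" and A: "A \<ge> 1"
    and upper_g: "\<And>s t. s < t \<Longrightarrow> d (g s) (g t) \<le> A * ln (real t - real s) + B"
    and upper_h: "\<And>s t. s < t \<Longrightarrow> euclid_dist m (h s) (h t) \<le> A * ln (real t - real s) + B"
    and lower: "\<And>s t. s < t \<Longrightarrow>
      ln (real t - real s) \<le> A * (d (g s) (g t) + euclid_dist m (h s) (h t)) + B"
  shows False
proof -
  obtain K :: nat where K: "K > 0" and packing: "\<And>\<rho> y. \<rho> > 0 \<Longrightarrow> \<not> (\<forall>i<K. \<forall>j<K. i \<noteq> j \<longrightarrow>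
      \<rho> \<le> euclid_dist m (y i) (y j) \<and> euclid_dist m (y i) (y j) \<le> (4 * A\<^sup>2) * \<rho>)"
    using euclid_packing_bound[of m "4 * A\<^sup>2"] by blast
  have B: "B \<ge> 0" using nonneg[OF X X, of 0 "Suc 0"] upper_g[of 0 "Suc 0"] by simp
  obtain J :: nat where J: "real J > 32 * A\<^sup>2" using reals_Archimedean2 by blast
  define \<Lambda>0 where "\<Lambda>0 = A * (real J * ln (2 * real K)) + 16 * A * B + 1"
  obtain M :: nat where M_large: "real M > exp \<Lambda>0" using reals_Archimedean2 by blast
  have M: "real M > 0" by (rule order.strict_trans[OF exp_gt_zero M_large])
  define \<Lambda> where "\<Lambda> = ln (real M)"
  have \<Lambda>ge: "\<Lambda> \<ge> \<Lambda>0" using ln_mono[of "exp \<Lambda>0" "real M"] M_large by (simp add: \<Lambda>_def)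
  have "ln (2 * real K) \<ge> 0" using K by (intro ln_ge_zero) linarith
  hence \<Lambda>0_pos: "A * (real J * ln (2 * real K)) \<ge> 0" using A by simp
  have AB: "A * B \<ge> 0" "A * B \<ge> B" using A B by (auto simp: mult_le_cancel_right1)
  have \<Lambda>: "\<Lambda> > 0" "16 * A * B \<le> \<Lambda>" "A * (real J * ln (2 * real K)) + B \<le> \<Lambda>"
    using \<Lambda>ge \<Lambda>0_pos AB by (auto simp: \<Lambda>0_def)
  define N where "N = M * (2 * K) ^ J"
  have lnN: "ln (real N) = \<Lambda> + real J * ln (2 * real K)"
    using M K by (simp add: N_def \<Lambda>_def ln_mult ln_realpow distrib_left)
  have log_bound: "A * ln (real t - real s) + B \<le> 2 * A * \<Lambda>" if "s < t" "t < N" for s t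
  proof -
    have "ln (real t - real s) \<le> ln (real N)" using that by (intro ln_mono) auto
    hence "A * ln (real t - real s) \<le> A * (\<Lambda> + real J * ln (2 * real K))"
      using A lnN by (simp add: mult_left_mono)
    also have "\<dots> = A * \<Lambda> + A * (real J * ln (2 * real K))" by (simp add: algebra_simps)
    also have "\<dots> + B \<le> A * \<Lambda> + \<Lambda>" using \<Lambda> by simp
    also have "\<dots> \<le> 2 * A * \<Lambda>" using A \<Lambda>(1) by simp
    finally show ?thesis by simp
  qed
  define r where "r = \<Lambda> / (8 * A)"
  have B_le: "B \<le> \<Lambda> / (16 * A)" using A \<Lambda>(2) by (simp add: field_simps)
  have step: "d (g t) (g (Suc t)) \<le> B" for t using upper_g[of t "Suc t"] by simp

  \<comment> \<open>Of the \<open>2 K\<close> consecutive subintervals of length \<open>S\<close>, only every second one is examined, so that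
    times chosen in different ones are at least \<open>S\<close> apart.\<close>
  have avoid: "\<exists>c\<ge>a. c + S \<le> a + 2 * K * S \<and> (\<forall>t\<in>{c..<c+S}. r < d (g t) q)"
    if q: "q \<in> X" and S: "M \<le> S" and bound: "a + 2 * K * S \<le> N" for a S q
  proof (rule ccontr)
    assume none: "\<not> ?thesis"
    have "\<exists>t. a + 2 * i * S \<le> t \<and> t < a + 2 * i * S + S \<and> d (g t) q \<le> r" if i: "i < K" for i
    proof -
      have "(2 * i + 1) * S \<le> 2 * K * S" using i by (intro mult_right_mono) auto
      hence "a + 2 * i * S + S \<le> a + 2 * K * S" by (simp add: algebra_simps)
      moreover have "a \<le> a + 2 * i * S" by simp
      ultimately have "\<not> (\<forall>t\<in>{a + 2 * i * S..<a + 2 * i * S + S}. r < d (g t) q)"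
        using none by blast
      thus ?thesis by (auto simp: not_less)
    qed
    then obtain \<tau> where \<tau>: "\<And>i. i < K \<Longrightarrow> a + 2 * i * S \<le> \<tau> i \<and> \<tau> i < a + 2 * i * S + S \<and> d (g (\<tau> i)) q \<le> r"
      by metis
    define \<rho> where "\<rho> = \<Lambda> / (2 * A)"
    have \<rho>: "\<rho> > 0" using \<Lambda> A by (simp add: \<rho>_def)
    have ratio: "\<rho> \<le> euclid_dist m (h (\<tau> i)) (h (\<tau> j)) \<and>
        euclid_dist m (h (\<tau> i)) (h (\<tau> j)) \<le> 4 * A\<^sup>2 * \<rho>" if ij: "i < j" "j < K" for i j
    proof -
      have "(2 * i + 2) * S \<le> 2 * j * S" using ij by (intro mult_right_mono) auto
      hence "\<tau> i + S \<le> \<tau> j" using \<tau>[of i] \<tau>[of j] ij by (simp add: algebra_simps)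
      hence gap: "\<tau> i < \<tau> j" "real M \<le> real (\<tau> j) - real (\<tau> i)" using S M by linarith+
      have "(2 * j + 1) * S \<le> 2 * K * S" using ij by (intro mult_right_mono) auto
      hence "\<tau> j < N" using \<tau>[of j] ij bound by (simp add: algebra_simps)
      hence up: "euclid_dist m (h (\<tau> i)) (h (\<tau> j)) \<le> 2 * A * \<Lambda>"
        using upper_h[OF gap(1)] log_bound[OF gap(1)] by linarith
      have "d (g (\<tau> i)) (g (\<tau> j)) \<le> 2 * r"
        using triangle[OF X q X, of "\<tau> i" "\<tau> j"] commute[OF X q, of "\<tau> j"] \<tau>[of i] \<tau>[of j] ij by simp
      hence "A * (d (g (\<tau> i)) (g (\<tau> j)) + euclid_dist m (h (\<tau> i)) (h (\<tau> j)))
           \<le> A * (2 * r + euclid_dist m (h (\<tau> i)) (h (\<tau> j)))" using A by simp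
      also have "\<dots> = \<Lambda> / 4 + A * euclid_dist m (h (\<tau> i)) (h (\<tau> j))"
        using A by (simp add: r_def algebra_simps)
      finally have "\<Lambda> - B \<le> \<Lambda> / 4 + A * euclid_dist m (h (\<tau> i)) (h (\<tau> j))"
        using lower[OF gap(1)] ln_mono[OF gap(2)] M by (simp add: \<Lambda>_def)
      moreover have "B \<le> \<Lambda> / 4" using \<Lambda>(2) AB by simp
      ultimately have "\<Lambda> / 2 \<le> A * euclid_dist m (h (\<tau> i)) (h (\<tau> j))" by simp
      hence "\<rho> \<le> euclid_dist m (h (\<tau> i)) (h (\<tau> j))" using A by (simp add: \<rho>_def field_simps)
      moreover have "4 * A\<^sup>2 * \<rho> = 2 * A * \<Lambda>" using A by (simp add: \<rho>_def power2_eq_square)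
      ultimately show ?thesis using up by linarith
    qed
    have sym: "euclid_dist m x y = euclid_dist m y x" for x y
      by (simp add: euclid_dist_def L2_set_def power2_commute)
    have "\<forall>i<K. \<forall>j<K. i \<noteq> j \<longrightarrow> \<rho> \<le> euclid_dist m (h (\<tau> i)) (h (\<tau> j)) \<and>
        euclid_dist m (h (\<tau> i)) (h (\<tau> j)) \<le> 4 * A\<^sup>2 * \<rho>"
      using ratio sym by (metis nat_neq_iff)
    thus False using packing[OF \<rho>, of "\<lambda>i. h (\<tau> i)"] by simp
  qed

  have N: "N > 0" using M K by (simp add: N_def)
  obtain s where s: "s < N" and s_min: "\<And>t. t < N \<Longrightarrow> d p (g s) \<le> d p (g t)"
    using ex_min_if_finite[of "(\<lambda>t. d p (g t)) ` {..<N}"] N by (fastforce simp: not_less)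
  \<comment> \<open>Round \<open>j\<close>: all points visited during some interval of length \<open>N / (2 K)\<^sup>j\<close> are at least
    \<open>j (r - B)\<close> higher than the lowest point visited before time \<open>N\<close>.\<close>
  have climb: "\<exists>a. a + M * (2 * K) ^ (J - j) \<le> N \<and>
      (\<forall>t\<in>{a..<a + M * (2 * K) ^ (J - j)}. d p (g s) + real j * (r - B) \<le> d p (g t))"
    if "j \<le> J" for j
    using that
  proof (induction j)
    case 0
    show ?case by (rule exI[of _ 0]) (use s_min in \<open>auto simp: N_def\<close>)
  next
    case (Suc j)
    define S where "S = M * (2 * K) ^ (J - Suc j)"
    have S2: "M * (2 * K) ^ (J - j) = 2 * K * S"
      using Suc.prems by (simp add: S_def Suc_diff_Suc[symmetric] del: Suc_diff_Suc)
    obtain a where a: "a + 2 * K * S \<le> N"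
      and high: "\<And>t. t \<in> {a..<a + 2 * K * S} \<Longrightarrow> d p (g s) + real j * (r - B) \<le> d p (g t)"
      using Suc unfolding S2 by auto
    have MS: "M \<le> S" using K by (simp add: S_def)
    have "{a..<a + 2 * K * S} \<noteq> {}" using MS M K by auto
    then obtain t0 where t0: "t0 \<in> {a..<a + 2 * K * S}"
      and t0_min: "\<And>t. t \<in> {a..<a + 2 * K * S} \<Longrightarrow> d p (g t0) \<le> d p (g t)"
      using ex_min_if_finite[of "(\<lambda>t. d p (g t)) ` {a..<a + 2 * K * S}"] by (fastforce simp: not_less)
    obtain c where c: "c \<ge> a" "c + S \<le> a + 2 * K * S" "\<And>t. t \<in> {c..<c+S} \<Longrightarrow> r < d (g t) (g t0)"
      using avoid[OF X MS a, of t0] by blast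
    have "d p (g s) + real (Suc j) * (r - B) \<le> d p (g t)" if t: "t \<in> {c..<c + S}" for t
      using coarse_path_lowest_point[OF X step t0_min t0, of t] t c(1,2) c(3)[OF t] high[OF t0]
      by (simp add: algebra_simps)
    thus ?case using a c(1,2) unfolding S_def[symmetric] by (intro exI[of _ c]) auto
  qed
  obtain a where a: "a + M \<le> N"
      "\<And>t. t \<in> {a..<a + M} \<Longrightarrow> d p (g s) + real J * (r - B) \<le> d p (g t)"
    using climb[of J] by auto
  have aN: "a < N" using a(1) M by linarith
  have "2 * A * \<Lambda> = 32 * A\<^sup>2 * (\<Lambda> / (16 * A))" using A by (simp add: power2_eq_square)
  also have "\<dots> < real J * (\<Lambda> / (16 * A))" using J \<Lambda> A by (intro mult_strict_right_mono) auto
  also have "\<dots> \<le> real J * (r - B)" using B_le by (intro mult_left_mono) (auto simp: r_def)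
  also have "\<dots> \<le> d p (g a) - d p (g s)" using a(2)[of a] M by simp
  also have "\<dots> \<le> d (g s) (g a)" using triangle[OF base X X, of a s] by simp
  also have "\<dots> \<le> 2 * A * \<Lambda>"
  proof (cases s a rule: linorder_cases)
    case less
    thus ?thesis using upper_g[OF less] log_bound[OF less aN] by linarith
  next
    case equal
    thus ?thesis using dist_refl[OF X] A \<Lambda> by simp
  next
    case greater
    thus ?thesis
      using upper_g[OF greater] log_bound[OF greater s] commute[OF X X, of s a] by linarith
  qed
  finally show False by simp
qed

end

section \<open>Closed walks and circuits\<close>

fun walk :: "('p, 'e) metric_graph \<Rightarrow> 'p \<Rightarrow> ('e \<times> 'p) list \<Rightarrow> 'p \<Rightarrow> bool" where
  "walk G u [] v \<longleftrightarrow> u = v"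
| "walk G u ((e, w) # xs) v \<longleftrightarrow> joins G u e w \<and> walk G w xs v"

lemma walk_append: "walk G u (xs @ ys) v \<longleftrightarrow> (\<exists>w. walk G u xs w \<and> walk G w ys v)"
  by (induction xs arbitrary: u) auto

lemma walk_nth:
  "walk G u xs v \<Longrightarrow> i < length xs \<Longrightarrow>
    joins G ((u # map snd xs) ! i) (map fst xs ! i) ((u # map snd xs) ! Suc i)"
proof (induction xs arbitrary: u i)
  case (Cons x xs)
  thus ?case by (cases x; cases i) auto
qed simp

lemma walk_last: "walk G u xs v \<Longrightarrow> last (u # map snd xs) = v"
  by (induction xs arbitrary: u) auto

text \<open>A closed walk lists its vertices from the second one on and ends where it starts, whereas a circuit
  lists each vertex once, with the starting vertex of each edge. Hence the shift by one.\<close>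

lemma closed_walk_circuit:
  assumes w: "walk G u xs u" and ne: "xs \<noteq> []"
    and dist: "distinct (map fst xs)" "distinct (map snd xs)"
  shows "circuit G (butlast (u # map snd xs)) (map fst xs)"
proof -
  define vs where "vs = u # map snd xs"
  have vs: "length vs = Suc (length xs)" "last vs = u" "vs ! 0 = u" "vs \<noteq> []"
    using walk_last[OF w] by (auto simp: vs_def)
  have last_nth: "vs ! length xs = u" using vs by (metis diff_Suc_1 last_conv_nth)
  have "joins G (butlast vs ! i) (map fst xs ! i) (butlast vs ! (Suc i mod length xs))"
    if i: "i < length xs" for i
  proof (cases "Suc i < length xs")
    case True
    thus ?thesis using walk_nth[OF w, of i] vs(1) by (simp add: vs_def[symmetric] nth_butlast)
  next
    case False
    hence "Suc i = length xs" using i by simp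
    thus ?thesis using walk_nth[OF w i] vs i ne last_nth
      by (simp add: vs_def[symmetric] nth_butlast)
  qed
  moreover have "distinct (butlast vs)"
  proof -
    have "map snd xs = butlast (map snd xs) @ [u]"
      using vs(2) ne by (metis append_butlast_last_id last_ConsR list.map_disc_iff vs_def)
    hence "distinct (butlast (map snd xs) @ [u])" using dist(2) by simp
    thus ?thesis using ne by (simp add: vs_def)
  qed
  ultimately show ?thesis using ne dist vs(1) by (simp add: circuit_def vs_def[symmetric])
qed


section \<open>Levels in a rooted tree\<close>

locale rooted_metric_tree =
  fixes G :: "('p, 'e) metric_graph" and root :: 'p
  assumes tree: "metric_tree G" and root: "root \<in> verts G"
begin

definition adjacent :: "'p \<Rightarrow> 'p \<Rightarrow> bool" where
  "adjacent u v \<longleftrightarrow> (\<exists>e. joins G u e v)"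

definition level :: "'p \<Rightarrow> nat" where
  "level v = (LEAST n. (adjacent ^^ n) root v)"

lemma joins_commute: "joins G u e v \<longleftrightarrow> joins G v e u"
  by (auto simp: joins_def)

lemma joins_verts: "joins G u e v \<Longrightarrow> u \<in> verts G \<and> v \<in> verts G"
  using tree by (auto simp: joins_def metric_tree_def wf_metric_graph_def)

lemma joins_ends: "joins G u e v \<Longrightarrow> joins G a e b \<Longrightarrow> a = u \<and> b = v \<or> a = v \<and> b = u"
  by (auto simp: joins_def)

lemma no_closed_walk:
  "walk G u xs u \<Longrightarrow> xs \<noteq> [] \<Longrightarrow> distinct (map fst xs) \<Longrightarrow> distinct (map snd xs) \<Longrightarrow> False"
  using closed_walk_circuit tree by (fastforce simp: metric_tree_def)

lemma level_attained:
  assumes "v \<in> verts G" shows "(adjacent ^^ level v) root v"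
proof -
  have "adjacent\<^sup>*\<^sup>* root v"
    using tree root assms by (simp add: metric_tree_def connected_graph_def adjacent_def[abs_def])
  thus ?thesis unfolding level_def by (metis LeastI rtranclp_power)
qed

lemma level_le: "(adjacent ^^ n) root v \<Longrightarrow> level v \<le> n"
  unfolding level_def by (rule Least_le)

lemma level_root [simp]: "level root = 0"
  using level_le[of 0 root] by simp

lemma level_eq_0: "v \<in> verts G \<Longrightarrow> level v = 0 \<Longrightarrow> v = root"
  using level_attained[of v] by simp

lemma level_step: "joins G u e v \<Longrightarrow> level v \<le> Suc (level u)"
  using level_attained[of u] joins_verts[of u e v]
  by (intro level_le) (auto simp: adjacent_def intro!: relcomppI)

lemma level_pred:
  assumes "v \<in> verts G" "level v = Suc k"
  obtains u e where "joins G u e v" "level u = k"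
proof -
  obtain u where u: "(adjacent ^^ k) root u" "adjacent u v"
    using level_attained[OF assms(1)] assms(2) by auto
  then obtain e where e: "joins G u e v" by (auto simp: adjacent_def)
  have "level u = k" using level_le[OF u(1)] level_step[OF e] assms(2) by simp
  thus ?thesis using that e by blast
qed

text \<open>Descend from both vertices, in each step to a neighbour of the next lower level. The two descents
  meet at some vertex, at the latest at the root, and up to the first such vertex they form a walk
  that has level \<open>k\<close> only at its ends. The information on levels is what guarantees that
  edges added at the ends are new, both in the induction and when the walk is closed up to
  a circuit.\<close>

lemma walk_below_level:
  assumes "u \<in> verts G" "v \<in> verts G" "u \<noteq> v" "level u = k" "level v = k"
  shows "\<exists>xs. walk G u xs v \<and> xs \<noteq> [] \<and> distinct (u # map snd xs) \<and> distinct (map fst xs) \<and>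
    (\<forall>x\<in>set (map snd xs). level x \<le> k) \<and>
    (\<forall>e\<in>set (map fst xs). \<forall>a b. joins G a e b \<longrightarrow> level a \<le> k \<and> level b \<le> k \<and> \<not> (level a = k \<and> level b = k))"
  using assms
proof (induction k arbitrary: u v)
  case 0
  thus ?case using level_eq_0 by metis
next
  case (Suc k)
  obtain u' e1 where u': "joins G u' e1 u" "level u' = k" using level_pred Suc.prems by metis
  obtain v' e2 where v': "joins G v' e2 v" "level v' = k" using level_pred Suc.prems by metis
  have j1: "joins G u e1 u'" using u' joins_commute by blast
  have ne: "u \<noteq> u'" "v \<noteq> v'" "u \<noteq> v'" "v \<noteq> u'" using Suc.prems u' v' by auto
  have ends: "level a \<le> Suc k \<and> level b \<le> Suc k \<and> \<not> (level a = Suc k \<and> level b = Suc k)"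
    if "joins G a e1 b \<or> joins G a e2 b" for a b
    using that joins_ends[OF u'(1)] joins_ends[OF v'(1)] u'(2) v'(2) Suc.prems(4,5) by fastforce
  have e12: "e1 \<noteq> e2" using joins_ends[OF u'(1)] v'(1) Suc.prems(3) ne by metis
  show ?case
  proof (cases "u' = v'")
    case True
    show ?thesis
      by (rule exI[of _ "[(e1, u'), (e2, v)]"])
         (use True j1 u' v' ne e12 ends Suc.prems in auto)
  next
    case False
    obtain xs where xs: "walk G u' xs v'" "xs \<noteq> []" "distinct (u' # map snd xs)"
      "distinct (map fst xs)" "\<And>x. x \<in> set (map snd xs) \<Longrightarrow> level x \<le> k"
      "\<And>e a b. e \<in> set (map fst xs) \<Longrightarrow> joins G a e b \<Longrightarrow> level a \<le> k \<and> level b \<le> k"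
      using Suc.IH[of u' v'] False u' v' joins_verts by blast
    define ys where "ys = (e1, u') # xs @ [(e2, v)]"
    have "walk G u ys v" using xs(1) j1 v'(1) by (auto simp: ys_def walk_append)
    moreover have "u \<notin> set (map snd xs)" "v \<notin> set (map snd xs)"
      using xs(5) Suc.prems(4,5) by fastforce+
    hence "distinct (u # map snd ys)" using xs(3) ne Suc.prems(3) by (simp add: ys_def)
    moreover have "e1 \<notin> set (map fst xs)" "e2 \<notin> set (map fst xs)"
      using xs(6) u'(1) v'(1) Suc.prems(4,5) by fastforce+
    hence "distinct (map fst ys)" using xs(4) e12 by (simp add: ys_def)
    moreover have "\<forall>x\<in>set (map snd ys). level x \<le> Suc k"
      using xs(5) u'(2) Suc.prems(5) by (fastforce simp: ys_def)
    moreover have "level a \<le> Suc k \<and> level b \<le> Suc k \<and> \<not> (level a = Suc k \<and> level b = Suc k)"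
      if "e \<in> set (map fst ys)" "joins G a e b" for e a b
    proof -
      have "e = e1 \<or> e = e2 \<or> e \<in> set (map fst xs)" using that(1) by (auto simp: ys_def)
      thus ?thesis using xs(6)[of e a b] ends[of a b] that(2) by fastforce
    qed
    moreover have "ys \<noteq> []" by (simp add: ys_def)
    ultimately show ?thesis by blast
  qed
qed

text \<open>An edge between two vertices of the same level would be a loop, or it would close the walk that
  joins them below that level to a circuit.\<close>

lemma edge_levels:
  assumes e: "joins G u e v"
  shows "level v = Suc (level u) \<or> level u = Suc (level v)"
proof (rule ccontr)
  assume "\<not> ?thesis"
  hence eq: "level u = level v"
    using level_step[OF e] level_step[of v e u] e joins_commute by fastforce
  have verts: "u \<in> verts G" "v \<in> verts G" using joins_verts[OF e] by auto
  show False
  proof (cases "u = v")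
    case True
    thus False using no_closed_walk[of u "[(e, u)]"] e by simp
  next
    case False
    obtain xs where xs: "walk G u xs v" "distinct (u # map snd xs)" "distinct (map fst xs)"
      "\<And>e a b. e \<in> set (map fst xs) \<Longrightarrow> joins G a e b \<Longrightarrow> \<not> (level a = level u \<and> level b = level u)"
      using walk_below_level[OF verts False HOL.refl] eq by metis
    have "e \<notin> set (map fst xs)" using xs(4) e eq by metis
    moreover have "walk G u (xs @ [(e, u)]) u"
      using xs(1) e joins_commute by (auto simp: walk_append)
    ultimately show False using no_closed_walk[of u "xs @ [(e, u)]"] xs by auto
  qed
qed

text \<open>Two different edges that descend from \<open>v\<close> would form a circuit, either with each other or with
  a walk that joins their lower ends and does not rise above the level of these.\<close>

lemma parent_unique:
  assumes j: "joins G u e v" "joins G u' e' v"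
    and lev: "level v = Suc (level u)" "level v = Suc (level u')"
  shows "u = u' \<and> e = e'"
proof -
  have j': "joins G v e u" using j joins_commute by blast
  have ne: "v \<noteq> u" "v \<noteq> u'" using lev by auto
  have "u = u'"
  proof (rule ccontr)
    assume False: "u \<noteq> u'"
    obtain xs where xs: "walk G u xs u'" "distinct (u # map snd xs)" "distinct (map fst xs)"
      "\<And>x. x \<in> set (map snd xs) \<Longrightarrow> level x \<le> level u"
      "\<And>e a b. e \<in> set (map fst xs) \<Longrightarrow> joins G a e b \<Longrightarrow> level a \<le> level u \<and> level b \<le> level u"
      using walk_below_level[of u u' "level u"] False j joins_verts lev
      by (metis nat.inject)
    have "e \<notin> set (map fst xs)" "e' \<notin> set (map fst xs)"
      using xs(5) j lev by fastforce+
    moreover have "e \<noteq> e'" using joins_ends[OF j(1)] j(2) False ne by metis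
    moreover have "v \<notin> set (map snd xs)" using xs(4) lev by fastforce
    moreover have "walk G v ((e, u) # xs @ [(e', v)]) v"
      using xs(1) j' j(2) by (auto simp: walk_append)
    ultimately show False
      using no_closed_walk[of v "(e, u) # xs @ [(e', v)]"] xs ne by auto
  qed
  moreover have "e = e'"
    using no_closed_walk[of v "[(e, u), (e', v)]"] j' j(2) ne \<open>u = u'\<close> by auto
  ultimately show ?thesis by simp
qed

section \<open>Addresses of vertices\<close>

text \<open>The list consists of the edges on a way from the root along which the level rises in every step.
  New edges are appended at the end, so that nested ways are prefixes of each other.\<close>

inductive geodesic_to :: "'p \<Rightarrow> 'e list \<Rightarrow> bool" where
  at_root: "geodesic_to root []"
| extend: "geodesic_to u q \<Longrightarrow> joins G u e v \<Longrightarrow> level v = Suc (level u) \<Longrightarrow> geodesic_to v (q @ [e])"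

lemma geodesic_to_unique: "geodesic_to v q \<Longrightarrow> geodesic_to v q' \<Longrightarrow> q = q'"
proof (induction arbitrary: q' rule: geodesic_to.induct)
  case at_root
  thus ?case by (cases rule: geodesic_to.cases) auto
next
  case (extend u q e v)
  from extend.prems show ?case
  proof (cases rule: geodesic_to.cases)
    case at_root
    thus ?thesis using extend.hyps by simp
  next
    case (extend u' q'' e')
    thus ?thesis using parent_unique \<open>joins G u e v\<close> \<open>level v = Suc (level u)\<close> \<open>\<And>q'. geodesic_to u q' \<Longrightarrow> q = q'\<close>
      by blast
  qed
qed

lemma geodesic_to_exists: "v \<in> verts G \<Longrightarrow> \<exists>q. geodesic_to v q"
proof (induction "level v" arbitrary: v)
  case 0
  thus ?case using level_eq_0 geodesic_to.at_root by metis
next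
  case (Suc k)
  obtain u e where "joins G u e v" "level u = k" using level_pred Suc by metis
  thus ?case using Suc geodesic_to.extend joins_verts by metis
qed

definition vertex_address :: "'p \<Rightarrow> 'e list" where
  "vertex_address v = (THE q. geodesic_to v q)"

lemma vertex_address_eq: "geodesic_to v q \<Longrightarrow> vertex_address v = q"
  unfolding vertex_address_def using geodesic_to_unique by blast

lemma geodesic_to_vertex_address: "v \<in> verts G \<Longrightarrow> geodesic_to v (vertex_address v)"
  using geodesic_to_exists vertex_address_eq by metis

lemma vertex_address_root [simp]: "vertex_address root = []"
  using vertex_address_eq geodesic_to.at_root by blast

lemma vertex_address_step:
  "joins G u e v \<Longrightarrow> level v = Suc (level u) \<Longrightarrow> vertex_address v = vertex_address u @ [e]"
  using geodesic_to_vertex_address geodesic_to.extend vertex_address_eq joins_verts by metis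

section \<open>Addresses and heights of points\<close>

definition upward :: "'e \<Rightarrow> bool" where
  "upward e \<longleftrightarrow> level (chart G e 0) < level (chart G e (len G e))"

text \<open>The charts are reparametrized so that the parameter \<open>a\<close> is always the distance from the end
  nearer to the root.\<close>

definition edge_point :: "'e \<Rightarrow> real \<Rightarrow> 'p" where
  "edge_point e a = chart G e (if upward e then a else len G e - a)"

abbreviation bottom :: "'e \<Rightarrow> 'p" where "bottom e \<equiv> edge_point e 0"
abbreviation top_end :: "'e \<Rightarrow> 'p" where "top_end e \<equiv> edge_point e (len G e)"

lemma len_pos: "e \<in> edges G \<Longrightarrow> 0 < len G e"
  using tree by (simp add: metric_tree_def wf_metric_graph_def)

lemma joins_bottom_top: "e \<in> edges G \<Longrightarrow> joins G (bottom e) e (top_end e)"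
  by (auto simp: joins_def edge_point_def)

lemma level_top: "e \<in> edges G \<Longrightarrow> level (top_end e) = Suc (level (bottom e))"
  using edge_levels[OF joins_bottom_top, of e] by (auto simp: edge_point_def upward_def split: if_splits)

lemma ends_verts: "e \<in> edges G \<Longrightarrow> bottom e \<in> verts G \<and> top_end e \<in> verts G"
  using joins_bottom_top joins_verts by blast

lemma vertex_address_top: "e \<in> edges G \<Longrightarrow> vertex_address (top_end e) = vertex_address (bottom e) @ [e]"
  using vertex_address_step joins_bottom_top level_top by blast

lemma vertex_address_snoc:
  assumes "v \<in> verts G" "vertex_address v = q @ [e]"
  shows "e \<in> edges G \<and> v = top_end e \<and> q = vertex_address (bottom e)"
proof -
  have "geodesic_to v (q @ [e])" using geodesic_to_vertex_address assms by metis
  then obtain u where u: "joins G u e v" "level v = Suc (level u)"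
    by (cases rule: geodesic_to.cases) auto
  have e: "e \<in> edges G" using u by (simp add: joins_def)
  have "u = bottom e \<and> v = top_end e"
    using joins_ends[OF joins_bottom_top[OF e] u(1)] level_top[OF e] u(2) by auto
  thus ?thesis using e vertex_address_top[OF e] assms(2) by simp
qed

lemma vertex_address_Nil: "v \<in> verts G \<Longrightarrow> vertex_address v = [] \<Longrightarrow> v = root"
  using geodesic_to_vertex_address[of v] by (auto elim: geodesic_to.cases)

lemma vertex_address_edges: "v \<in> verts G \<Longrightarrow> set (vertex_address v) \<subseteq> edges G"
proof -
  have "geodesic_to v q \<Longrightarrow> set q \<subseteq> edges G" for q
    by (induction rule: geodesic_to.induct) (auto simp: joins_def)
  thus "v \<in> verts G \<Longrightarrow> set (vertex_address v) \<subseteq> edges G"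
    using geodesic_to_vertex_address by blast
qed

lemma edge_point_cases:
  assumes "x \<in> points G"
  obtains "x \<in> verts G" | e a where "e \<in> edges G" "0 < a" "a < len G e" "x = edge_point e a"
proof (cases "x \<in> verts G")
  case False
  then obtain e s where e: "e \<in> edges G" "0 \<le> s" "s \<le> len G e" "x = chart G e s"
    using assms by (auto simp: points_def)
  have ends: "chart G e 0 \<in> verts G" "chart G e (len G e) \<in> verts G"
    using e(1) tree by (auto simp: metric_tree_def wf_metric_graph_def)
  hence "s \<noteq> 0" "s \<noteq> len G e" using e False by auto
  hence s: "0 < s" "s < len G e" using e by auto
  show ?thesis
    by (rule that(2)[of e "if upward e then s else len G e - s"])
       (use e s in \<open>auto simp: edge_point_def\<close>)
qed (use that in blast)

lemma edge_point_interior: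
  assumes "e \<in> edges G" "0 < a" "a < len G e"
  shows "edge_point e a \<in> chart G e ` {0<..<len G e}" "edge_point e a \<notin> verts G"
proof -
  show *: "edge_point e a \<in> chart G e ` {0<..<len G e}"
    using assms by (auto simp: edge_point_def)
  have "chart G e ` {0<..<len G e} \<inter> verts G = {}"
    using tree assms by (simp add: metric_tree_def wf_metric_graph_def)
  thus "edge_point e a \<notin> verts G" using * by blast
qed

lemma edge_point_inj:
  assumes e: "e \<in> edges G" "0 < a" "a < len G e" and e': "e' \<in> edges G" "0 < a'" "a' < len G e'"
    and eq: "edge_point e a = edge_point e' a'"
  shows "e = e' \<and> a = a'"
proof -
  have disj: "\<And>e e'. e \<in> edges G \<Longrightarrow> e' \<in> edges G \<Longrightarrow> e \<noteq> e' \<Longrightarrow>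
      chart G e ` {0<..<len G e} \<inter> chart G e' ` {0<..<len G e'} = {}"
    using tree by (simp add: metric_tree_def wf_metric_graph_def)
  have ee: "e = e'"
    using disj[OF e(1) e'(1)] edge_point_interior(1)[OF e] edge_point_interior(1)[OF e'] eq by auto
  have inj: "inj_on (chart G e) {0<..<len G e}"
    using tree e by (simp add: metric_tree_def wf_metric_graph_def)
  define s where "s = (if upward e then a else len G e - a)"
  define s' where "s' = (if upward e then a' else len G e - a')"
  have "chart G e s = chart G e s'" using eq unfolding ee edge_point_def s_def s'_def .
  moreover have "s \<in> {0<..<len G e}" "s' \<in> {0<..<len G e}"
    using e e' ee by (auto simp: s_def s'_def)
  ultimately have "s = s'" using inj by (simp add: inj_onD)
  thus ?thesis using ee by (simp add: s_def s'_def split: if_splits)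
qed

definition total_length :: "'e list \<Rightarrow> real" where
  "total_length q = sum_list (map (len G) q)"

lemma total_length_simps [simp]:
  "total_length [] = 0" "total_length (q @ q') = total_length q + total_length q'"
  "total_length [e] = len G e"
  by (simp_all add: total_length_def)

lemma total_length_nonneg: "set q \<subseteq> edges G \<Longrightarrow> 0 \<le> total_length q"
  unfolding total_length_def by (rule sum_list_nonneg) (auto dest!: len_pos subsetD)

lemma total_length_prefix: "prefix q q' \<Longrightarrow> set q' \<subseteq> edges G \<Longrightarrow> total_length q \<le> total_length q'"
  by (auto simp: prefix_def total_length_nonneg)

text \<open>A point in the interior of an edge is given the address of the upper end of that edge, because
  this address determines the edge. Its height is then less than the total length of its address,
  whereas for vertices the two are equal.\<close>

inductive located :: "'p \<Rightarrow> 'e list \<Rightarrow> real \<Rightarrow> bool" where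
  vertex: "v \<in> verts G \<Longrightarrow> located v (vertex_address v) (total_length (vertex_address v))"
| interior: "e \<in> edges G \<Longrightarrow> 0 < a \<Longrightarrow> a < len G e \<Longrightarrow>
    located (edge_point e a) (vertex_address (top_end e)) (total_length (vertex_address (bottom e)) + a)"

lemma located_unique:
  assumes "located x q h" "located x q' h'"
  shows "q' = q \<and> h' = h"
  using assms(1)
proof cases
  case vertex
  from assms(2) show ?thesis
  proof cases
    case interior
    thus ?thesis using vertex edge_point_interior(2) by blast
  qed (use vertex in simp)
next
  case (interior e a)
  from assms(2) show ?thesis
  proof cases
    case vertex
    thus ?thesis using interior edge_point_interior(2) by blast
  next
    case (interior e' a')
    hence "e = e' \<and> a = a'" using edge_point_inj \<open>x = edge_point e a\<close> \<open>e \<in> edges G\<close> \<open>0 < a\<close> \<open>a < len G e\<close>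
      by blast
    thus ?thesis using interior \<open>q = _\<close> \<open>h = _\<close> by simp
  qed
qed

lemma located_exists: "x \<in> points G \<Longrightarrow> \<exists>q h. located x q h"
  by (erule edge_point_cases) (auto intro: located.intros)

definition address :: "'p \<Rightarrow> 'e list" where "address x = (THE q. \<exists>h. located x q h)"
definition height :: "'p \<Rightarrow> real" where "height x = (THE h. \<exists>q. located x q h)"

lemma address_height_eq:
  assumes "located x q h"
  shows "address x = q \<and> height x = h"
  unfolding address_def height_def
  using assms by (auto dest: located_unique intro!: the_equality)

lemma located_address_height: "x \<in> points G \<Longrightarrow> located x (address x) (height x)"
  using located_exists address_height_eq by metis

lemma address_vertex: "v \<in> verts G \<Longrightarrow> address v = vertex_address v"
  and height_vertex: "v \<in> verts G \<Longrightarrow> height v = total_length (vertex_address v)"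
  using address_height_eq[OF located.vertex] by auto

lemma chart_in_points: "e \<in> edges G \<Longrightarrow> s \<in> {0..len G e} \<Longrightarrow> chart G e s \<in> points G"
  unfolding points_def by blast

lemma edge_point_in_points: "e \<in> edges G \<Longrightarrow> 0 \<le> a \<Longrightarrow> a \<le> len G e \<Longrightarrow> edge_point e a \<in> points G"
  by (simp add: edge_point_def chart_in_points)

lemma address_height_edge_point:
  assumes e: "e \<in> edges G" and a: "0 \<le> a" "a \<le> len G e"
  shows "height (edge_point e a) = height (bottom e) + a"
    and "0 < a \<Longrightarrow> address (edge_point e a) = address (bottom e) @ [e]"
proof -
  have "height (edge_point e a) = height (bottom e) + a \<and>
    (0 < a \<longrightarrow> address (edge_point e a) = address (bottom e) @ [e])"
  proof (cases "0 < a \<and> a < len G e")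
    case True
    thus ?thesis using address_height_eq[OF located.interior, of e a] e ends_verts[OF e]
      by (simp add: address_vertex height_vertex vertex_address_top)
  next
    case False
    hence "a = 0 \<or> a = len G e" using a by auto
    thus ?thesis using e ends_verts[OF e] len_pos[OF e]
      by (auto simp: address_vertex height_vertex vertex_address_top)
  qed
  thus "height (edge_point e a) = height (bottom e) + a"
    and "0 < a \<Longrightarrow> address (edge_point e a) = address (bottom e) @ [e]" by auto
qed

lemma address_edges:
  assumes "x \<in> points G"
  shows "set (address x) \<subseteq> edges G"
  using located_address_height[OF assms]
  by cases (use ends_verts vertex_address_edges in \<open>metis\<close>)+

lemma address_snoc:
  assumes x: "x \<in> points G" and q: "address x = q @ [e]"
  obtains a where "e \<in> edges G" "0 < a" "a \<le> len G e" "x = edge_point e a"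
    "address (bottom e) = q" "height x = height (bottom e) + a"
proof (cases rule: edge_point_cases[OF x])
  case 1
  hence "vertex_address x = q @ [e]" using q address_vertex by simp
  hence *: "e \<in> edges G" "x = top_end e" "q = vertex_address (bottom e)"
    using vertex_address_snoc 1 by auto
  have addr: "address (bottom e) = q" using * ends_verts[OF *(1)] by (simp add: address_vertex)
  show ?thesis
    using that[OF *(1) len_pos[OF *(1)] order.refl *(2) addr]
      address_height_edge_point(1)[OF *(1), of "len G e"] len_pos[OF *(1)] *(2) by simp
next
  case (2 e' a)
  have "address x = address (bottom e') @ [e']" using address_height_edge_point(2)[of e' a] 2 by simp
  hence "e' = e" "address (bottom e') = q" using q by auto
  thus ?thesis using that 2 address_height_edge_point(1)[of e' a] by simp
qed

lemma address_Nil: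
  assumes "x \<in> points G" "address x = []"
  shows "x = root"
proof (cases rule: edge_point_cases[OF assms(1)])
  case 1
  thus ?thesis using assms(2) by (simp add: address_vertex vertex_address_Nil)
next
  case (2 e a)
  thus ?thesis using assms(2) address_height_edge_point(2)[of e a] by simp
qed

lemma height_bottom: "e \<in> edges G \<Longrightarrow> height (bottom e) = total_length (address (bottom e))"
  using ends_verts[of e] by (simp add: address_vertex height_vertex)

lemma height_le:
  assumes x: "x \<in> points G"
  shows "height x \<le> total_length (address x)"
proof (cases "address x" rule: rev_cases)
  case Nil
  hence "x = root" using address_Nil x by blast
  thus ?thesis using root by (simp add: height_vertex address_vertex)
next
  case (snoc q e)
  then obtain a where "e \<in> edges G" "a \<le> len G e" "address (bottom e) = q"
    "height x = height (bottom e) + a" using address_snoc[OF x snoc] by metis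
  thus ?thesis using snoc height_bottom by simp
qed

lemma height_nonneg:
  assumes "x \<in> points G"
  shows "0 \<le> height x"
proof -
  have vert: "0 \<le> height v" if "v \<in> verts G" for v
    using that by (simp add: height_vertex total_length_nonneg vertex_address_edges)
  show ?thesis
  proof (cases rule: edge_point_cases[OF assms])
    case (2 e a)
    thus ?thesis using address_height_edge_point(1)[of e a] vert[of "bottom e"] ends_verts[of e] by simp
  qed (rule vert)
qed

section \<open>The path metric of a tree is 0-hyperbolic\<close>

text \<open>The length of the common part of the two routes from the root; it is the Gromov product of the
  two points. The heights enter because a route may stop inside the last edge of its
  address.\<close>

definition overlap :: "'p \<Rightarrow> 'p \<Rightarrow> real" where
  "overlap x y = min (min (height x) (height y))
     (total_length (longest_common_prefix (address x) (address y)))"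

definition tree_dist :: "'p \<Rightarrow> 'p \<Rightarrow> real" where
  "tree_dist x y = height x + height y - 2 * overlap x y"

lemma longest_common_prefix_commute: "longest_common_prefix xs ys = longest_common_prefix ys xs"
  by (meson longest_common_prefix_max_prefix longest_common_prefix_prefix1
      longest_common_prefix_prefix2 prefix_order.antisym)

lemma overlap_commute: "overlap x y = overlap y x"
  by (simp add: overlap_def longest_common_prefix_commute min.commute)

lemma overlap_le: "overlap x y \<le> height x" "overlap x y \<le> height y"
  by (auto simp: overlap_def)

lemma overlap_geI:
  assumes "x \<in> points G" "prefix q (address x)" "prefix q (address y)"
    and "h \<le> height x" "h \<le> height y" "h \<le> total_length q"
  shows "h \<le> overlap x y"
proof -
  have "total_length q \<le> total_length (longest_common_prefix (address x) (address y))"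
    using assms longest_common_prefix_max_prefix[of q "address x" "address y"]
      longest_common_prefix_prefix1[of "address x" "address y"] address_edges[OF assms(1)]
    by (intro total_length_prefix) (auto dest: set_mono_prefix)
  thus ?thesis using assms by (simp add: overlap_def)
qed

lemma overlap_self: "x \<in> points G \<Longrightarrow> overlap x x = height x"
  using overlap_geI[of x "address x" x "height x"] overlap_le[of x x] height_le[of x] by simp

text \<open>The prefixes that \<open>y\<close> shares with \<open>x\<close> and with \<open>z\<close> are both prefixes of the address of \<open>y\<close>, so one
  is contained in the other, and the shorter one is common to \<open>x\<close> and \<open>z\<close>.\<close>

lemma overlap_ultrametric:
  assumes "x \<in> points G" "y \<in> points G" "z \<in> points G"
  shows "min (overlap x y) (overlap y z) \<le> overlap x z"
proof -
  let ?q = "longest_common_prefix (address x) (address y)"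
  let ?q' = "longest_common_prefix (address y) (address z)"
  consider "prefix ?q ?q'" | "prefix ?q' ?q"
    using prefix_same_cases[of ?q "address y" ?q'] longest_common_prefix_prefix1
      longest_common_prefix_prefix2 by blast
  thus ?thesis
  proof cases
    case 1
    hence "prefix ?q (address z)"
      using longest_common_prefix_prefix2 prefix_order.trans by blast
    moreover have "overlap x y \<le> total_length ?q" by (simp add: overlap_def)
    ultimately show ?thesis
      using overlap_le[of x y] overlap_le[of y z] assms
      by (intro overlap_geI[of x ?q]) (auto simp: longest_common_prefix_prefix1)
  next
    case 2
    hence "prefix ?q' (address x)"
      using longest_common_prefix_prefix1 prefix_order.trans by blast
    moreover have "overlap y z \<le> total_length ?q'" by (simp add: overlap_def)
    ultimately show ?thesis
      using overlap_le[of x y] overlap_le[of y z] assms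
      by (intro overlap_geI[of x ?q']) (auto simp: longest_common_prefix_prefix2)
  qed
qed

lemma tree_dist_self: "x \<in> points G \<Longrightarrow> tree_dist x x = 0"
  by (simp add: tree_dist_def overlap_self)

lemma tree_dist_commute: "tree_dist x y = tree_dist y x"
  by (simp add: tree_dist_def overlap_commute)

lemma tree_dist_triangle:
  "x \<in> points G \<Longrightarrow> y \<in> points G \<Longrightarrow> z \<in> points G \<Longrightarrow> tree_dist x z \<le> tree_dist x y + tree_dist y z"
  using overlap_ultrametric[of x y z] overlap_le[of x y] overlap_le[of y z]
  unfolding tree_dist_def by linarith

lemma tree_dist_edge_point:
  assumes e: "e \<in> edges G" and ab: "0 \<le> a" "a \<le> b" "b \<le> len G e"
  shows "tree_dist (edge_point e a) (edge_point e b) \<le> b - a"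
proof -
  have pts: "edge_point e a \<in> points G" "edge_point e b \<in> points G"
    using edge_point_in_points[OF e] ab by auto
  have hts: "height (edge_point e a) = height (bottom e) + a" "height (edge_point e b) = height (bottom e) + b"
    using address_height_edge_point(1)[OF e, of a] address_height_edge_point(1)[OF e, of b] ab
    by simp_all
  have "height (edge_point e a) \<le> overlap (edge_point e a) (edge_point e b)"
  proof (rule overlap_geI[of _ "address (edge_point e a)"])
    show "prefix (address (edge_point e a)) (address (edge_point e b))"
      using address_height_edge_point(2)[OF e, of a] address_height_edge_point(2)[OF e, of b] ab
      by (cases "a = 0"; cases "b = 0") simp_all
  qed (use pts hts ab height_le[OF pts(1)] in simp_all)
  thus ?thesis using hts by (simp add: tree_dist_def)
qed

lemma tree_dist_chart:
  assumes e: "e \<in> edges G" and st: "s \<in> {0..len G e}" "t \<in> {0..len G e}"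
  shows "tree_dist (chart G e s) (chart G e t) \<le> \<bar>s - t\<bar>"
proof -
  define a where "a = (if upward e then s else len G e - s)"
  define b where "b = (if upward e then t else len G e - t)"
  have eq: "chart G e s = edge_point e a" "chart G e t = edge_point e b"
    by (simp_all add: a_def b_def edge_point_def)
  have "\<bar>s - t\<bar> = \<bar>a - b\<bar>" "0 \<le> a" "0 \<le> b" "a \<le> len G e" "b \<le> len G e"
    using st by (auto simp: a_def b_def)
  thus ?thesis
    using tree_dist_edge_point[OF e, of a b] tree_dist_edge_point[OF e, of b a]
      tree_dist_commute[of "edge_point e a" "edge_point e b"]
    unfolding eq by (cases "a \<le> b") auto
qed

lemma path_points: "path_of_length G x y r \<Longrightarrow> x \<in> points G \<and> y \<in> points G"
  by (induction rule: path_of_length.induct) (auto intro: chart_in_points)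

text \<open>By the triangle inequality it suffices to compare the two distances within a single edge.\<close>

lemma tree_dist_le_path: "path_of_length G x y r \<Longrightarrow> tree_dist x y \<le> r"
proof (induction rule: path_of_length.induct)
  case (refl x)
  thus ?case by (simp add: tree_dist_self)
next
  case (step x e s r t)
  have "chart G e t \<in> points G" using step by (simp add: chart_in_points)
  thus ?case
    using tree_dist_triangle[of x "chart G e s" "chart G e t"] tree_dist_chart[of e s t]
      path_points[OF step.hyps(1)] step by simp
qed

lemma path_append:
  assumes "path_of_length G x y r" "path_of_length G y z r'"
  shows "path_of_length G x z (r + r')"
  using assms(2,1)
proof (induction rule: path_of_length.induct)
  case (step y e s r' t)
  thus ?case using path_of_length.step[of G x e s "r + r'" t] by (simp add: add.assoc)
qed simp

lemma path_edge_points: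
  assumes e: "e \<in> edges G" and "0 \<le> a" "a \<le> len G e" "0 \<le> b" "b \<le> len G e"
  shows "path_of_length G (edge_point e a) (edge_point e b) \<bar>a - b\<bar>"
proof -
  define s where "s = (if upward e then a else len G e - a)"
  define t where "t = (if upward e then b else len G e - b)"
  have "path_of_length G (chart G e s) (chart G e t) (0 + \<bar>s - t\<bar>)"
    by (intro path_of_length.step path_of_length.refl)
       (use assms in \<open>auto simp: s_def t_def intro!: chart_in_points\<close>)
  moreover have "\<bar>s - t\<bar> = \<bar>a - b\<bar>" by (auto simp: s_def t_def)
  ultimately show ?thesis by (simp add: s_def t_def edge_point_def)
qed

text \<open>If the routes to \<open>x\<close> and \<open>y\<close> part no later than at the lower end of the edge of \<open>x\<close>, then a shortest path
  from \<open>x\<close> to \<open>y\<close> begins with the way down to that end.\<close>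

lemma tree_dist_descend:
  assumes x: "x \<in> points G" "y \<in> points G" and e: "e \<in> edges G" "0 \<le> a" "a \<le> len G e" "x = edge_point e a"
    and below: "overlap x y \<le> height (bottom e)"
  shows "tree_dist x y = a + tree_dist (bottom e) y"
proof -
  have b: "bottom e \<in> points G" using edge_point_in_points[OF e(1)] len_pos[OF e(1)] by auto
  have hx: "height x = height (bottom e) + a"
    using address_height_edge_point(1)[of e a] e by simp
  have "overlap x (bottom e) = height (bottom e)"
  proof -
    have "tree_dist (bottom e) x \<le> a" using tree_dist_edge_point[of e 0 a] e by simp
    thus ?thesis using hx overlap_le[of x "bottom e"] tree_dist_commute[of x "bottom e"]
      by (simp add: tree_dist_def)
  qed
  hence "overlap (bottom e) y = overlap x y"
    using overlap_ultrametric[of "bottom e" x y] overlap_ultrametric[of x "bottom e" y]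
      x b below overlap_le[of "bottom e" y] overlap_commute[of x "bottom e"] by simp
  thus ?thesis using hx by (simp add: tree_dist_def)
qed

text \<open>If the route to \<open>y\<close> shares with that to \<open>x\<close> a part of positive length of the last edge \<open>e\<close>, then it
  enters that edge as well.\<close>

lemma longest_common_prefix_eq_address:
  assumes x: "x \<in> points G" "address x = p @ [e]" and above: "total_length p < overlap x y"
  shows "longest_common_prefix (address x) (address y) = address x"
proof (rule ccontr)
  assume ne: "\<not> ?thesis"
  have "prefix (longest_common_prefix (address x) (address y)) (p @ [e])"
    using longest_common_prefix_prefix1[of "address x" "address y"] x(2) by simp
  hence "prefix (longest_common_prefix (address x) (address y)) p"
    using ne x(2) by (simp add: prefix_snoc)
  hence "total_length (longest_common_prefix (address x) (address y)) \<le> total_length p"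
    using address_edges[OF x(1)] x(2) by (intro total_length_prefix) auto
  thus False using above by (simp add: overlap_def)
qed

text \<open>The path goes down from \<open>x\<close> and from \<open>y\<close>, edge by edge, as long as the routes from the root have
  parted no later than at the lower end of the current edge. When neither can go down any further, both points lie on the same
  edge, or both are the root.\<close>

lemma path_tree_dist:
  "x \<in> points G \<Longrightarrow> y \<in> points G \<Longrightarrow> path_of_length G x y (tree_dist x y)"
proof (induction "length (address x) + length (address y)" arbitrary: x y rule: less_induct)
  case less
  note IH = less.hyps and x = less.prems(1) and y = less.prems(2)
  show ?case
  proof (cases "address x = [] \<and> address y = []")
    case True
    hence "x = root" "y = root" using address_Nil x y by auto
    thus ?thesis using path_of_length.refl[OF x] tree_dist_self[OF x] by simp
  next
    case False
    consider (descend_x) p e a where "address x = p @ [e]" "e \<in> edges G" "0 < a" "a \<le> len G e"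
          "x = edge_point e a" "address (bottom e) = p" "overlap x y \<le> height (bottom e)"
      | (descend_y) p e a where "address y = p @ [e]" "e \<in> edges G" "0 < a" "a \<le> len G e"
          "y = edge_point e a" "address (bottom e) = p" "overlap y x \<le> height (bottom e)"
      | (same) e a b where "e \<in> edges G" "0 < a" "a \<le> len G e" "0 < b" "b \<le> len G e"
          "x = edge_point e a" "y = edge_point e b"
    proof (cases "address x" rule: rev_cases)
      case Nil
      then obtain p e where y_addr: "address y = p @ [e]" using False by (metis rev_exhaust)
      obtain a where a: "e \<in> edges G" "0 < a" "a \<le> len G e" "y = edge_point e a"
        "address (bottom e) = p" using address_snoc[OF y y_addr] by metis
      have "overlap y x \<le> 0" using overlap_le(2)[of y x] height_le[OF x] Nil by simp
      also have "0 \<le> height (bottom e)"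
        using height_nonneg ends_verts[OF a(1)] by (simp add: points_def)
      finally show ?thesis using descend_y[OF y_addr a(1-5)] by blast
    next
      case (snoc p e)
      obtain a where a: "e \<in> edges G" "0 < a" "a \<le> len G e" "x = edge_point e a"
        "address (bottom e) = p" using address_snoc[OF x snoc] by metis
      show ?thesis
      proof (cases "overlap x y \<le> height (bottom e)")
        case True
        thus ?thesis using descend_x[OF snoc a] by blast
      next
        case False
        hence lcp: "longest_common_prefix (address x) (address y) = p @ [e]"
          using longest_common_prefix_eq_address[OF x snoc, of y] height_bottom[OF a(1)] a(5) snoc by simp
        hence "address y \<noteq> []"
          using longest_common_prefix_prefix2[of "address x" "address y"] by auto
        then obtain p' e' where y_addr: "address y = p' @ [e']" by (metis rev_exhaust)
        obtain b where b: "e' \<in> edges G" "0 < b" "b \<le> len G e'" "y = edge_point e' b"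
          "address (bottom e') = p'" using address_snoc[OF y y_addr] by metis
        show ?thesis
        proof (cases "overlap y x \<le> height (bottom e')")
          case True
          thus ?thesis using descend_y[OF y_addr b] by blast
        next
          case False
          hence "longest_common_prefix (address y) (address x) = p' @ [e']"
            using longest_common_prefix_eq_address[OF y y_addr, of x] height_bottom[OF b(1)] b(5) y_addr
            by simp
          hence "e = e'" using lcp longest_common_prefix_commute by (metis last_snoc)
          thus ?thesis using a b same by blast
        qed
      qed
    qed
    thus ?thesis
    proof cases
      case x: (descend_x p e a)
      have b: "bottom e \<in> points G" using edge_point_in_points[OF x(2)] len_pos[OF x(2)] by auto
      have "path_of_length G (bottom e) y (tree_dist (bottom e) y)"
        using IH[of "bottom e" y] b less.prems x by simp
      hence "path_of_length G x y (\<bar>a - 0\<bar> + tree_dist (bottom e) y)"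
        using path_append path_edge_points[of e a 0] x len_pos[OF x(2)] by auto
      thus ?thesis using tree_dist_descend[of x y e a] x less.prems by simp
    next
      case y: (descend_y p e a)
      have b: "bottom e \<in> points G" using edge_point_in_points[OF y(2)] len_pos[OF y(2)] by auto
      have "path_of_length G x (bottom e) (tree_dist x (bottom e))"
        using IH[of x "bottom e"] b less.prems y by simp
      hence "path_of_length G x y (tree_dist x (bottom e) + \<bar>0 - a\<bar>)"
        using path_append path_edge_points[of e 0 a] y len_pos[OF y(2)] by auto
      thus ?thesis using tree_dist_descend[of y x e a] y less.prems
        by (simp add: tree_dist_commute add.commute)
    next
      case (same e a b)
      have path: "path_of_length G x y \<bar>a - b\<bar>" using path_edge_points[of e a b] same by simp
      have "height x = height (bottom e) + a" "height y = height (bottom e) + b"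
        using address_height_edge_point(1)[of e a] address_height_edge_point(1)[of e b] same
        by simp_all
      hence "\<bar>a - b\<bar> \<le> tree_dist x y" using overlap_le[of x y] by (simp add: tree_dist_def)
      hence "tree_dist x y = \<bar>a - b\<bar>" using tree_dist_le_path[OF path] by simp
      thus ?thesis using path by simp
    qed
  qed
qed

lemma path_dist_eq_tree_dist:
  assumes "x \<in> points G" "y \<in> points G"
  shows "path_dist G x y = tree_dist x y"
  unfolding path_dist_def
  by (rule cInf_eq_minimum) (use assms path_tree_dist tree_dist_le_path in auto)

lemma zero_hyperbolic_path_dist: "zero_hyperbolic (points G) (path_dist G) root"
proof
  show base: "root \<in> points G" using root by (simp add: points_def)
  fix x y z assume pts: "x \<in> points G" "y \<in> points G" "z \<in> points G"
  have "height root = 0" using root by (simp add: height_vertex)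
  hence "overlap root v = 0" if "v \<in> points G" for v
    using that overlap_le(1)[of root v] height_nonneg[OF that]
      overlap_geI[OF base, of "[]" v 0] by simp
  hence gp: "gromov_product (path_dist G) root u v = overlap u v"
    if "u \<in> points G" "v \<in> points G" for u v
    using that base \<open>height root = 0\<close>
    by (simp add: gromov_product_def path_dist_eq_tree_dist tree_dist_def)
  show "min (gromov_product (path_dist G) root x y) (gromov_product (path_dist G) root y z)
      \<le> gromov_product (path_dist G) root x z"
    using gp pts overlap_ultrametric by simp
qed (auto simp: path_dist_eq_tree_dist tree_dist_self tree_dist_commute tree_dist_triangle)

end

section \<open>The hyperbolic plane and products of a tree with a Euclidean space\<close>

lemma prod_dist_bounds:
  assumes "0 \<le> d1 (fst x) (fst y)" "0 \<le> d2 (snd x) (snd y)"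
  shows "d1 (fst x) (fst y) \<le> prod_dist d1 d2 x y" "d2 (snd x) (snd y) \<le> prod_dist d1 d2 x y"
    and "prod_dist d1 d2 x y \<le> d1 (fst x) (fst y) + d2 (snd x) (snd y)"
  using assms sqrt_sum_squares_le_sum[OF assms]
  by (simp_all add: prod_dist_def case_prod_unfold real_le_rsqrt)

theorem theorem1p4:
  fixes T :: "('p, 'e) metric_graph" and m :: nat
  assumes "metric_tree T"
  shows "\<nexists>f. quasi_isometric_embedding hyp_plane hyp_dist
              (points T \<times> topspace (Euclidean_space m))
              (prod_dist (path_dist T) (euclid_dist m)) f"
proof
  assume "\<exists>f. quasi_isometric_embedding hyp_plane hyp_dist
              (points T \<times> topspace (Euclidean_space m))
              (prod_dist (path_dist T) (euclid_dist m)) f"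
  then obtain f l \<mu> where f: "f \<in> hyp_plane \<rightarrow> points T \<times> topspace (Euclidean_space m)"
    and l: "l \<ge> 1" and \<mu>: "\<mu> \<ge> 0"
    and qi: "\<And>x y. x \<in> hyp_plane \<Longrightarrow> y \<in> hyp_plane \<Longrightarrow>
      1 / l * hyp_dist x y - \<mu> \<le> prod_dist (path_dist T) (euclid_dist m) (f x) (f y) \<and>
      prod_dist (path_dist T) (euclid_dist m) (f x) (f y) \<le> l * hyp_dist x y + \<mu>"
    unfolding quasi_isometric_embedding_def by blast
  obtain root where root: "root \<in> verts T"
    using assms by (auto simp: metric_tree_def connected_graph_def)
  interpret rooted_metric_tree T root by unfold_locales (rule assms, rule root)
  interpret tree: zero_hyperbolic "points T" "path_dist T" root
    by (rule zero_hyperbolic_path_dist)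
  define z where "z = (\<lambda>t::nat. Complex (real t) 1)"
  define g where "g = (\<lambda>t. fst (f (z t)))"
  define h where "h = (\<lambda>t. snd (f (z t)))"
  have z: "z t \<in> hyp_plane" for t by (simp add: z_def hyp_plane_def)
  have g: "g t \<in> points T" for t using f z[of t] by (auto simp: g_def Pi_iff mem_Times_iff)
  \<comment> \<open>One additive constant that serves for both the upper and the lower estimates.\<close>
  define B where "B = 2 * l + \<mu> + l * \<mu> + 1"
  have l\<mu>: "l * \<mu> \<ge> 0" using l \<mu> by simp
  have bounds: "path_dist T (g s) (g t) \<le> 2 * l * ln (real t - real s) + B \<and>
      euclid_dist m (h s) (h t) \<le> 2 * l * ln (real t - real s) + B \<and>
      ln (real t - real s) \<le> 2 * l * (path_dist T (g s) (g t) + euclid_dist m (h s) (h t)) + B"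
    if "s < t" for s t
  proof -
    let ?L = "ln (real t - real s)"
    let ?D = "prod_dist (path_dist T) (euclid_dist m) (f (z s)) (f (z t))"
    have nonneg: "0 \<le> path_dist T (g s) (g t)" "0 \<le> euclid_dist m (h s) (h t)"
      using tree.nonneg[OF g g] by (simp_all add: euclid_dist_def L2_set_nonneg)
    have parts: "path_dist T (g s) (g t) \<le> ?D" "euclid_dist m (h s) (h t) \<le> ?D"
      "?D \<le> path_dist T (g s) (g t) + euclid_dist m (h s) (h t)"
      using prod_dist_bounds[of "path_dist T" "f (z s)" "f (z t)" "euclid_dist m"] nonneg
      by (simp_all add: g_def h_def)
    have "?D \<le> l * hyp_dist (z s) (z t) + \<mu>" using qi[OF z z] by blast
    also have "\<dots> \<le> l * (2 * ?L + 2) + \<mu>"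
      using horocycle_dist_bounds(2)[OF that] l by (simp add: z_def)
    also have "\<dots> \<le> 2 * l * ?L + B" using l\<mu> by (simp add: B_def algebra_simps)
    finally have upper: "?D \<le> 2 * l * ?L + B" .
    have "hyp_dist (z s) (z t) \<le> l * (?D + \<mu>)"
      using qi[OF z z, of s t] l by (simp add: field_simps)
    hence "2 * ?L - 1 \<le> l * ?D + l * \<mu>"
      using horocycle_dist_bounds(1)[OF that] by (simp add: z_def algebra_simps)
    moreover have "0 \<le> ?L" using that by (intro ln_ge_zero) simp
    moreover have "l * ?D \<le> l * (path_dist T (g s) (g t) + euclid_dist m (h s) (h t))"
      using parts(3) l by (intro mult_left_mono) auto
    moreover have "0 \<le> l * (path_dist T (g s) (g t) + euclid_dist m (h s) (h t))"
      using nonneg l by simp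
    ultimately have "?L \<le> 2 * (l * (path_dist T (g s) (g t) + euclid_dist m (h s) (h t))) + B"
      using l \<mu> l\<mu> unfolding B_def by linarith
    thus ?thesis using upper parts by simp
  qed
  show False
    by (rule tree.no_log_embedding[of g "2 * l" B m h]) (use g l bounds in auto)
qed

end
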